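(* For all $n\ge 2$, $full_n^{P_2^{(2,2)}}=C_{n-1}$, where $C_n=\frac{1}{n+1}\binom{2n}{n}$ is the $n$-th Catalan number.
   Context: $\mathcal{F}_{n,2}$ is the set of all fillings $F$ of the $2\times n$ rectangular array (2 rows, $n$ columns) with the integers $1,\dots,2n$, each used once, such that in each column the bottom entry is smaller than the top entry. $P_2^{(2,2)}\in\mathcal{F}_{2,2}$ is the filling with bottom row $1,2$ and top row $3,4$ (reading left to right). For a $2\times 2$ filling by distinct positive integers, $\mathrm{red}$ replaces the $i$-th smallest entry by $i$. $F\in\mathcal{F}_{n,2}$ has a $P$-match starting at position $i$ ($1\le i\le n-1$) if the reduction of the $2\times2$ filling formed by columns $i,i+1$ of $F$ equals $P$. $full_n^{P}$ is the number of $F\in\mathcal{F}_{n,2}$ having $P$-matches starting at every position $1,\dots,n-1$. *)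

theory Defs
  imports Complex_Main
begin

text \<open>A two-row array is a list of columns, read left to right; a column is the pair
  (bottom entry, top entry).\<close>

type_synonym filling = "(nat \<times> nat) list"

definition entries :: "filling \<Rightarrow> nat list" where
  "entries F = map fst F @ map snd F"

definition fillings :: "nat \<Rightarrow> filling set" where
  "fillings n = {F. length F = n \<and> distinct (entries F) \<and> set (entries F) = {1..2 * n} \<and>
     (\<forall>(b, t) \<in> set F. b < t)}"

definition red :: "filling \<Rightarrow> filling" where
  "red F = (let rank = (\<lambda>x. card {y \<in> set (entries F). y \<le> x}) in map (map_prod rank rank) F)"

text \<open>Positions are counted from 1, list elements from 0.\<close>

definition match_at :: "filling \<Rightarrow> filling \<Rightarrow> nat \<Rightarrow> bool" where
  "match_at P F i \<longleftrightarrow> red [F ! (i - 1), F ! i] = P"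

definition full :: "filling \<Rightarrow> nat \<Rightarrow> nat" where
  "full P n = card {F \<in> fillings n. \<forall>i \<in> {1..n - 1}. match_at P F i}"

text \<open>Bottom row 1, 2 and top row 3, 4.\<close>

definition P2_22 :: filling where
  "P2_22 = [(1, 3), (2, 4)]"

definition catalan :: "nat \<Rightarrow> real" where
  "catalan n = 1 / (real n + 1) * real ((2 * n) choose n)"

end

theory Submission
  imports Defs
begin

text \<open>Two adjacent columns \<open>(a, b)\<close>, \<open>(c, d)\<close> form a match exactly when \<open>a < c < b < d\<close>. So a
  filling that matches everywhere has increasing rows \<open>b\<^sub>1 < \<dots> < b\<^sub>n\<close> and \<open>t\<^sub>1 < \<dots> < t\<^sub>n\<close> with
  \<open>b\<^sub>i\<^sub>+\<^sub>1 < t\<^sub>i\<close>: read in increasing order of the entries, with the bottom entries as up-steps and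
  the top entries as down-steps, it is a Dyck path that returns to the axis only at its end.

  The largest entry \<open>2 n\<close> is necessarily \<open>t\<^sub>n\<close>, so it may be deleted. This leaves rows of lengths
  \<open>n\<close> and \<open>n - 1\<close> with the same inequalities, and pairs of rows of general lengths \<open>q < p\<close> can be
  counted by removing the largest entry, which ends one of the two rows
  (\<open>card_linked_rows_Suc_Suc\<close>).
  This is the recurrence of the ballot numbers, whose solution is a difference of two binomial
  coefficients by Pascal's rule (\<open>card_linked_rows\<close>). For rows of lengths \<open>n\<close> and \<open>n - 1\<close>
  this difference is the Catalan number of index \<open>n - 1\<close>.\<close>

section \<open>Matches as inequalities\<close>

lemma red_eq_P2_22_iff:
  "red [(a, b), (c, d)] = P2_22 \<longleftrightarrow> a < c \<and> c < b \<and> b < d"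
proof
  define r where "r x = card {y \<in> {a, b, c, d}. y \<le> x}" for x
  have set_eq: "set (entries [(a, b), (c, d)]) = {a, b, c, d}"
    by (auto simp: entries_def)
  have red_eq: "red [(a, b), (c, d)] = [(r a, r b), (r c, r d)]"
    unfolding red_def set_eq Let_def r_def by simp
  have mono: "r x \<le> r y" if "x \<le> y" for x y
    unfolding r_def using that by (intro card_mono) auto
  {
    assume "red [(a, b), (c, d)] = P2_22"
    then have "r a = 1" "r c = 2" "r b = 3" "r d = 4"
      by (auto simp: red_eq P2_22_def)
    then show "a < c \<and> c < b \<and> b < d"
      using mono[of c a] mono[of b c] mono[of d b] by linarith
  }
  {
    assume *: "a < c \<and> c < b \<and> b < d"
    then have "{y \<in> {a, b, c, d}. y \<le> a} = {a}" "{y \<in> {a, b, c, d}. y \<le> c} = {a, c}"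
      "{y \<in> {a, b, c, d}. y \<le> b} = {a, c, b}" "{y \<in> {a, b, c, d}. y \<le> d} = {a, c, b, d}"
      by auto
    then have "r a = 1" "r c = 2" "r b = 3" "r d = 4"
      unfolding r_def using * by auto
    then show "red [(a, b), (c, d)] = P2_22"
      by (simp add: red_eq P2_22_def)
  }
qed

lemma match_at_everywhere_iff:
  assumes "length xs = length ys"
  shows "(\<forall>i \<in> {1..length xs - 1}. match_at P2_22 (zip xs ys) i) \<longleftrightarrow>
    sorted_wrt (<) xs \<and> sorted_wrt (<) ys \<and> (\<forall>i < length xs - 1. xs ! Suc i < ys ! i)"
proof -
  have "(\<forall>i \<in> {1..length xs - 1}. match_at P2_22 (zip xs ys) i) \<longleftrightarrow>
    (\<forall>i < length xs - 1. match_at P2_22 (zip xs ys) (Suc i))"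
    unfolding image_Suc_lessThan[symmetric] by blast
  also have "\<dots> \<longleftrightarrow>
    (\<forall>i < length xs - 1. xs ! i < xs ! Suc i \<and> xs ! Suc i < ys ! i \<and> ys ! i < ys ! Suc i)"
    using assms by (auto simp: match_at_def red_eq_P2_22_iff)
  also have "\<dots> \<longleftrightarrow> sorted_wrt (<) xs \<and> sorted_wrt (<) ys \<and>
    (\<forall>i < length xs - 1. xs ! Suc i < ys ! i)"
    using assms by (auto simp: sorted_wrt_iff_nth_Suc_transp less_diff_conv)
  finally show ?thesis .
qed

section \<open>Pairs of rows of different lengths\<close>

text \<open>The pairs of increasing rows of lengths \<open>q < p\<close> that use each of \<open>1, \<dots>, p + q\<close> once, such
  that every entry of the shorter row exceeds the entry of the longer row one place further to the
  right. The set is empty unless \<open>q < p\<close>, so that this further entry exists.\<close>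

definition linked_rows :: "nat \<Rightarrow> nat \<Rightarrow> (nat list \<times> nat list) set" where
  "linked_rows p q = {(xs, ys). q < p \<and> length xs = p \<and> length ys = q \<and>
     sorted_wrt (<) xs \<and> sorted_wrt (<) ys \<and> set xs \<inter> set ys = {} \<and>
     set xs \<union> set ys = {1..p + q} \<and> (\<forall>i < q. xs ! Suc i < ys ! i)}"

lemma finite_linked_rows: "finite (linked_rows p q)"
proof (rule finite_subset)
  show "linked_rows p q \<subseteq> {xs. set xs \<subseteq> {1..p + q} \<and> length xs = p} \<times>
      {ys. set ys \<subseteq> {1..p + q} \<and> length ys = q}"
    unfolding linked_rows_def by blast
qed (intro finite_cartesian_product finite_lists_length_eq; simp)

lemma linked_rows_empty: "p \<le> q \<Longrightarrow> linked_rows p q = {}"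
  by (auto simp: linked_rows_def)

lemma sorted_wrt_less_snoc_max:
  fixes zs :: "'a :: linorder list"
  assumes "sorted_wrt (<) zs" "m \<in> set zs" "\<And>z. z \<in> set zs \<Longrightarrow> z \<le> m"
  shows "zs = butlast zs @ [m]"
proof (cases zs rule: rev_cases)
  case (snoc us u)
  then have "u = m"
    using assms by (fastforce simp: sorted_wrt_append)
  with snoc show ?thesis by simp
qed (use assms in simp)

lemma linked_rows_0: "linked_rows (Suc p) 0 = {([1..<p + 2], [])}"
proof -
  have set_upt: "set [1..<p + 2] = {1..Suc p}"
    by auto
  have "sorted_wrt (<) xs \<and> set xs = {1..Suc p} \<longleftrightarrow> xs = [1..<p + 2]" for xs
    using strict_sorted_equal[of xs "[1..<p + 2]"] sorted_wrt_upt[of 1 "p + 2"] set_upt by metis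
  then have "(xs, ys) \<in> linked_rows (Suc p) 0 \<longleftrightarrow> xs = [1..<p + 2] \<and> ys = []" for xs ys
    unfolding linked_rows_def by (cases ys) (auto simp del: upt_Suc)
  then show ?thesis by auto
qed

lemma linked_rows_Suc_Suc:
  assumes "q < p"
  shows "linked_rows (Suc p) (Suc q) =
    (\<lambda>(xs, ys). (xs @ [p + q + 2], ys)) ` linked_rows p (Suc q) \<union>
    (\<lambda>(xs, ys). (xs, ys @ [p + q + 2])) ` linked_rows (Suc p) q"
    (is "?L = ?f ` ?A \<union> ?g ` ?B")
proof (intro equalityI subsetI)
  fix z assume "z \<in> ?L"
  then obtain xs ys where z: "z = (xs, ys)"
    and len: "length xs = Suc p" "length ys = Suc q"
    and sorted: "sorted_wrt (<) xs" "sorted_wrt (<) ys"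
    and disj: "set xs \<inter> set ys = {}"
    and un: "set xs \<union> set ys = {1..p + q + 2}"
    and link: "\<And>i. i < Suc q \<Longrightarrow> xs ! Suc i < ys ! i"
    by (auto simp: linked_rows_def)
  have le: "v \<le> p + q + 2" if "v \<in> set xs \<union> set ys" for v
    using that un by simp
  have rest: "{1..p + q + 2} - {p + q + 2} = {1..p + q + 1}"
    by auto
  have "p + q + 2 \<in> set xs \<union> set ys"
    by (simp add: un)
  then show "z \<in> ?f ` ?A \<union> ?g ` ?B"
  proof
    assume "p + q + 2 \<in> set xs"
    then obtain us where us: "xs = us @ [p + q + 2]"
      using sorted_wrt_less_snoc_max[OF sorted(1)] le by blast
    then have lus: "length us = p"
      using len by simp
    \<comment> \<open>For \<open>p = q + 1\<close> the last entry of \<open>xs\<close> would be bounded by that of \<open>ys\<close>.\<close>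
    have "Suc q \<noteq> p"
    proof
      assume "Suc q = p"
      then have "p + q + 2 < ys ! q"
        using link[of q] lus by (simp add: us nth_append)
      moreover have "ys ! q \<in> set ys"
        using len by simp
      ultimately show False
        using le by fastforce
    qed
    then have "Suc q < p"
      using assms by simp
    moreover have "set us \<union> set ys = {1..p + Suc q}"
    proof -
      have "p + q + 2 \<notin> set us \<union> set ys"
        using sorted(1) disj by (auto simp: us sorted_wrt_append)
      then have "set us \<union> set ys = (set xs \<union> set ys) - {p + q + 2}"
        by (auto simp: us)
      then show ?thesis
        using un rest by simp
    qed
    moreover have "us ! Suc i < ys ! i" if "i < Suc q" for i
      using link[OF that] that \<open>Suc q < p\<close> lus by (simp add: us nth_append)
    ultimately have "(us, ys) \<in> ?A"
      using len lus sorted disj by (auto simp: linked_rows_def us sorted_wrt_append)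
    then show ?thesis
      by (force simp: z us)
  next
    assume "p + q + 2 \<in> set ys"
    then obtain vs where vs: "ys = vs @ [p + q + 2]"
      using sorted_wrt_less_snoc_max[OF sorted(2)] le by blast
    then have lvs: "length vs = q"
      using len by simp
    have "set xs \<union> set vs = {1..Suc p + q}"
    proof -
      have "p + q + 2 \<notin> set xs \<union> set vs"
        using sorted(2) disj by (auto simp: vs sorted_wrt_append)
      then have "set xs \<union> set vs = (set xs \<union> set ys) - {p + q + 2}"
        by (auto simp: vs)
      then show ?thesis
        using un rest by simp
    qed
    moreover have "xs ! Suc i < vs ! i" if "i < q" for i
      using link[of i] that lvs by (simp add: vs nth_append)
    ultimately have "(xs, vs) \<in> ?B"
      using len lvs sorted disj assms by (auto simp: linked_rows_def vs sorted_wrt_append)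
    then show ?thesis
      by (force simp: z vs)
  qed
next
  fix z assume "z \<in> ?f ` ?A \<union> ?g ` ?B"
  then show "z \<in> ?L"
  proof
    assume "z \<in> ?f ` ?A"
    then obtain us ys where z: "z = (us @ [p + q + 2], ys)" and "Suc q < p"
      and len: "length us = p" "length ys = Suc q"
      and sorted: "sorted_wrt (<) us" "sorted_wrt (<) ys"
      and disj: "set us \<inter> set ys = {}"
      and un: "set us \<union> set ys = {1..p + q + 1}"
      and link: "\<And>i. i < Suc q \<Longrightarrow> us ! Suc i < ys ! i"
      by (auto simp: linked_rows_def)
    have less: "v < p + q + 2" if "v \<in> set us \<union> set ys" for v
      using that un by simp
    have "set (us @ [p + q + 2]) \<union> set ys = insert (p + q + 2) {1..p + q + 1}"
      using un by auto
    also have "\<dots> = {1..Suc p + Suc q}"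
      by auto
    finally have "set (us @ [p + q + 2]) \<union> set ys = {1..Suc p + Suc q}" .
    moreover have "(us @ [p + q + 2]) ! Suc i < ys ! i" if "i < Suc q" for i
      using link[OF that] that \<open>Suc q < p\<close> len by (simp add: nth_append)
    moreover have "p + q + 2 \<notin> set ys"
      using less by blast
    ultimately show ?thesis
      using len sorted disj less \<open>Suc q < p\<close>
      by (simp add: z linked_rows_def sorted_wrt_append)
  next
    assume "z \<in> ?g ` ?B"
    then obtain xs vs where z: "z = (xs, vs @ [p + q + 2])"
      and len: "length xs = Suc p" "length vs = q"
      and sorted: "sorted_wrt (<) xs" "sorted_wrt (<) vs"
      and disj: "set xs \<inter> set vs = {}"
      and un: "set xs \<union> set vs = {1..p + q + 1}"
      and link: "\<And>i. i < q \<Longrightarrow> xs ! Suc i < vs ! i"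
      by (auto simp: linked_rows_def)
    have less: "v < p + q + 2" if "v \<in> set xs \<union> set vs" for v
      using that un by simp
    have "set xs \<union> set (vs @ [p + q + 2]) = insert (p + q + 2) {1..p + q + 1}"
      using un by auto
    also have "\<dots> = {1..Suc p + Suc q}"
      by auto
    finally have "set xs \<union> set (vs @ [p + q + 2]) = {1..Suc p + Suc q}" .
    moreover have "xs ! Suc i < (vs @ [p + q + 2]) ! i" if "i < Suc q" for i
    proof (cases "i < q")
      case True
      then show ?thesis
        using link len by (simp add: nth_append)
    next
      case False
      then have "i = q"
        using that by simp
      moreover have "xs ! Suc q \<in> set xs"
        using len assms by simp
      ultimately show ?thesis
        using less len by (simp add: nth_append)
    qed
    moreover have "p + q + 2 \<notin> set xs"
      using less by blast
    ultimately show ?thesis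
      using len sorted disj less assms
      by (simp add: z linked_rows_def sorted_wrt_append)
  qed
qed

lemma card_linked_rows_Suc_Suc:
  assumes "q < p"
  shows "card (linked_rows (Suc p) (Suc q)) =
    card (linked_rows p (Suc q)) + card (linked_rows (Suc p) q)"
proof -
  let ?f = "\<lambda>(xs, ys :: nat list). (xs @ [p + q + 2], ys)"
  let ?g = "\<lambda>(xs :: nat list, ys). (xs, ys @ [p + q + 2])"
  have "?f ` linked_rows p (Suc q) \<inter> ?g ` linked_rows (Suc p) q = {}"
  proof -
    \<comment> \<open>The second image has \<open>p + q + 2\<close> in the second row, the first image does not.\<close>
    have "p + q + 2 \<notin> set ys" if "(xs, ys) \<in> linked_rows p (Suc q)" for xs ys
    proof
      assume "p + q + 2 \<in> set ys"
      moreover have "set ys \<subseteq> {1..p + Suc q}"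
        using that unfolding linked_rows_def by blast
      ultimately show False by auto
    qed
    then show ?thesis by fastforce
  qed
  then have "card (linked_rows (Suc p) (Suc q)) =
      card (?f ` linked_rows p (Suc q)) + card (?g ` linked_rows (Suc p) q)"
    by (simp add: linked_rows_Suc_Suc[OF assms] card_Un_disjoint finite_linked_rows)
  also have "\<dots> = card (linked_rows p (Suc q)) + card (linked_rows (Suc p) q)"
    by (subst (1 2) card_image) (auto simp: inj_on_def)
  finally show ?thesis .
qed

text \<open>The bound \<open>q \<le> p + 1\<close> includes the boundary case \<open>q = p + 1\<close>, where both binomial
  coefficients agree and there are no rows; the recurrence needs it.\<close>

lemma card_linked_rows:
  "q \<le> Suc p \<Longrightarrow> card (linked_rows (Suc p) q) + ((p + q) choose Suc p) = (p + q) choose p"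
proof (induction "p + q" arbitrary: p q rule: less_induct)
  case less
  consider "q = 0" | "q = Suc p" | k p' where "q = Suc k" "p = Suc p'" "k \<le> p'"
    using less.prems by (cases q; cases p) (auto simp: le_Suc_eq)
  then show ?case
  proof cases
    case 1
    then show ?thesis by (simp add: linked_rows_0)
  next
    case 2
    then show ?thesis
      using binomial_symmetric[of p "p + Suc p"] by (simp add: linked_rows_empty)
  next
    case 3
    have "card (linked_rows (Suc p') q) + ((p' + q) choose Suc p') = (p' + q) choose p'"
      by (rule less.hyps) (use 3 in auto)
    moreover have "card (linked_rows (Suc p) k) + ((p + k) choose Suc p) = (p + k) choose p"
      by (rule less.hyps) (use 3 in auto)
    ultimately show ?thesis
      using 3 card_linked_rows_Suc_Suc[of k p] by simp
  qed
qed

section \<open>From fillings to rows\<close>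

text \<open>A filling that matches everywhere is determined by its rows, and its largest entry \<open>2 n\<close>
  ends the top row.\<close>

lemma full_P2_22_eq_card_linked_rows:
  assumes "n \<ge> 1"
  shows "full P2_22 n = card (linked_rows n (n - 1))"
proof -
  define S where "S = {F \<in> fillings n. \<forall>i \<in> {1..n - 1}. match_at P2_22 F i}"
  define f where "f = (\<lambda>F :: filling. (map fst F, butlast (map snd F)))"
  define g :: "nat list \<times> nat list \<Rightarrow> filling"
    where "g = (\<lambda>(xs, ys). zip xs (ys @ [2 * n]))"
  have rest: "{1..2 * n} - {2 * n} = {1..n + (n - 1)}"
    using assms by auto
  have to_rows: "f F \<in> linked_rows n (n - 1) \<and> g (f F) = F" if "F \<in> S" for F
  proof -
    define xs ys where "xs = map fst F" and "ys = map snd F"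
    have F: "F = zip xs ys"
      by (simp add: xs_def ys_def zip_map_fst_snd)
    have len: "length xs = n" "length ys = n"
      and dist: "distinct (xs @ ys)"
      and un: "set xs \<union> set ys = {1..2 * n}"
      and less: "\<forall>(b, t) \<in> set F. b < t"
      using that by (auto simp: S_def fillings_def entries_def xs_def ys_def)
    have sorted: "sorted_wrt (<) xs" "sorted_wrt (<) ys"
      and link: "\<And>i. i < n - 1 \<Longrightarrow> xs ! Suc i < ys ! i"
      using that match_at_everywhere_iff[of xs ys] len by (auto simp: S_def F)
    have le: "v \<le> 2 * n" if "v \<in> set xs \<union> set ys" for v
      using that un by simp
    have "2 * n \<notin> set xs"
    proof
      assume "2 * n \<in> set xs"
      then obtain t where "(2 * n, t) \<in> set F"
        by (auto simp: xs_def)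
      then have "2 * n < t" "t \<in> set ys"
        using less by (auto simp: ys_def image_iff intro: bexI[of _ "(2 * n, t)"])
      then show False
        using le by fastforce
    qed
    moreover have "2 * n \<in> set xs \<union> set ys"
      using assms by (simp add: un)
    ultimately obtain vs where vs: "ys = vs @ [2 * n]"
      using sorted_wrt_less_snoc_max[OF sorted(2)] le by blast
    have lvs: "length vs = n - 1"
      using len by (simp add: vs)
    have "set xs \<union> set vs = (set xs \<union> set ys) - {2 * n}"
      using \<open>2 * n \<notin> set xs\<close> dist by (auto simp: vs)
    then have "set xs \<union> set vs = {1..n + (n - 1)}"
      using un rest by simp
    moreover have "xs ! Suc i < vs ! i" if "i < n - 1" for i
      using link[OF that] that lvs by (simp add: vs nth_append)
    ultimately have "(xs, vs) \<in> linked_rows n (n - 1)"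
      using len lvs sorted dist assms by (auto simp: linked_rows_def vs sorted_wrt_append)
    moreover have "f F = (xs, vs)"
      unfolding f_def xs_def[symmetric] ys_def[symmetric] by (simp add: vs)
    ultimately show ?thesis
      by (simp add: g_def F vs)
  qed
  have to_filling: "g z \<in> S \<and> f (g z) = z" if "z \<in> linked_rows n (n - 1)" for z
  proof -
    obtain xs vs where z: "z = (xs, vs)"
      by (cases z)
    have len: "length xs = n" "length vs = n - 1"
      and sorted: "sorted_wrt (<) xs" "sorted_wrt (<) vs"
      and disj: "set xs \<inter> set vs = {}"
      and un: "set xs \<union> set vs = {1..n + (n - 1)}"
      and link: "\<And>i. i < n - 1 \<Longrightarrow> xs ! Suc i < vs ! i"
      using that by (simp_all add: linked_rows_def z)
    define ys where "ys = vs @ [2 * n]"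
    have lys: "length ys = n"
      using len assms by (simp add: ys_def)
    have gz: "g z = zip xs ys"
      by (simp add: g_def z ys_def)
    have less: "v < 2 * n" if "v \<in> set xs \<union> set vs" for v
      using that assms un by auto
    have sorted': "sorted_wrt (<) ys"
      using sorted(2) less by (auto simp: ys_def sorted_wrt_append)
    have link': "xs ! Suc i < ys ! i" if "i < n - 1" for i
      using link[OF that] that len by (simp add: ys_def nth_append)
    have column: "xs ! i < ys ! i" if "i < n" for i
    proof (cases "i < n - 1")
      case True
      then have "xs ! i < xs ! Suc i"
        using sorted(1) len by (simp add: sorted_wrt_nth_less)
      then show ?thesis
        using link'[OF True] by simp
    next
      case False
      then have "i = n - 1"
        using that by simp
      then show ?thesis
        using less[of "xs ! i"] len that by (simp add: ys_def nth_append)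
    qed
    have "\<forall>(b, t) \<in> set (g z). b < t"
      using column len lys by (auto simp: gz set_zip)
    moreover have "distinct (xs @ ys)"
      using sorted(1) sorted' disj less
      by (auto simp: ys_def strict_sorted_iff)
    moreover have "set xs \<union> set ys = {1..2 * n}"
    proof -
      have "set xs \<union> set ys = insert (2 * n) {1..n + (n - 1)}"
        using un by (auto simp: ys_def)
      also have "\<dots> = {1..2 * n}"
        unfolding rest[symmetric] using assms by (intro insert_Diff) simp
      finally show ?thesis .
    qed
    moreover have "entries (g z) = xs @ ys" "length (g z) = n"
      using len lys by (simp_all add: entries_def gz)
    ultimately have "g z \<in> fillings n"
      by (simp add: fillings_def)
    moreover have "\<forall>i \<in> {1..n - 1}. match_at P2_22 (g z) i"
      using match_at_everywhere_iff[of xs ys] len lys sorted(1) sorted' link' by (simp add: gz)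
    ultimately have "g z \<in> S"
      by (simp add: S_def)
    moreover have "f (g z) = z"
      unfolding f_def gz using len lys by (simp add: z) (simp add: ys_def)
    ultimately show ?thesis by blast
  qed
  have "bij_betw f S (linked_rows n (n - 1))"
    by (rule bij_betw_byWitness[where f' = g]) (use to_rows to_filling in auto)
  then show ?thesis
    by (simp add: full_def S_def bij_betw_same_card)
qed

lemma catalan_eq_diff_binomial:
  "catalan m = real ((2 * m) choose m) - real ((2 * m) choose Suc m)"
proof -
  have "Suc m * ((2 * m) choose Suc m) = m * ((2 * m) choose m)"
    unfolding binomial_absorption binomial_absorb_comp[symmetric] by simp
  then have "real (Suc m * ((2 * m) choose Suc m)) = real (m * ((2 * m) choose m))"
    by (rule arg_cong)
  then have "(real m + 1) * real ((2 * m) choose Suc m) = real m * real ((2 * m) choose m)"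
    unfolding of_nat_mult by (simp add: add.commute)
  then show ?thesis
    by (simp add: catalan_def field_simps)
qed

theorem theorem12:
  fixes n :: nat
  assumes "n \<ge> 2"
  shows "real (full P2_22 n) = catalan (n - 1)"
proof -
  define m where "m = n - 1"
  have "full P2_22 n = card (linked_rows (Suc m) m)"
    using full_P2_22_eq_card_linked_rows[of n] assms by (simp add: m_def)
  moreover have "card (linked_rows (Suc m) m) + ((2 * m) choose Suc m) = (2 * m) choose m"
    using card_linked_rows[of m m] by (simp add: mult_2)
  ultimately show ?thesis
    unfolding catalan_eq_diff_binomial m_def[symmetric] by linarith
qed

end
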